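(* Let $k\in\mathbb N$, $k\ge4$. Then $\mathcal F^{\mathbb R}_{k,2}$ is connected.
   Context: $\mathcal F^{\mathbb R}_{k,n}$ is the space of spherical tight frames of $k$ vectors in $\mathbb R^n$: all ordered lists $(f_1,\dots,f_k)$ of unit vectors in $\mathbb R^n$ for which there is $B>0$ with $\sum_{i=1}^k|\langle v,f_i\rangle|^2=B\|v\|^2$ for all $v\in\mathbb R^n$, with the relative topology from $(\mathbb R^n)^k$. *)

theory Defs
  imports "HOL-Analysis.Analysis"
begin

text \<open>
  An ordered list of \<open>k\<close> vectors is an extensional function on the index set \<open>{..<k}\<close>, so that lists
  correspond one-to-one to the points of \<^term>\<open>product_topology (\<lambda>_. euclidean) {..<k}\<close>.
\<close>

definition spherical_tight_frames :: "nat \<Rightarrow> (nat \<Rightarrow> real ^ 'n) set" where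
  "spherical_tight_frames k =
     {f \<in> {..<k} \<rightarrow>\<^sub>E UNIV.
        (\<forall>i<k. norm (f i) = 1) \<and>
        (\<exists>B>0. \<forall>v. (\<Sum>i<k. \<bar>v \<bullet> f i\<bar>\<^sup>2) = B * (norm v)\<^sup>2)}"

definition stf_space :: "nat \<Rightarrow> (nat \<Rightarrow> real ^ 'n) topology" where
  "stf_space k =
     subtopology (product_topology (\<lambda>_. euclidean) {..<k}) (spherical_tight_frames k)"

end

theory Submission
  imports Defs
begin

text \<open>
  Identify the plane with the complex numbers. A list of unit vectors is a tight frame iff the squares
  of the corresponding unit complex numbers sum to zero (\<open>tight_iff_sum_squares_0\<close>). Group the list into
  \<open>m \<ge> 2\<close> pairs, with one vector left over if the length is odd. Writing a pair as
  \<open>(cis (\<theta> + \<phi>), cis (\<theta> - \<phi>))\<close>, the sum of its squares is \<open>2 * cos (2 * \<phi>) * cis (2 * \<theta>)\<close>, and this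
  map from the torus of pairs to the disc of radius 2 has the lifting property for segments
  (\<open>unit_pair_segment_lift\<close>), even through the origin. Hence every configuration can be moved so that
  all pairs have the same sum of squares (\<open>configs_balance\<close>), and by a rotation the odd vector can be
  brought to 1.

  It remains to join two configurations with the same sums of squares for all pairs. One pair is
  exchanged for another in the same fibre while a second pair compensates its motion and finally returns
  to its initial position (\<open>two_pairs_exchange\<close>). The sheets of the fibre are joined over two kinds of
  points of the disc: over 0 the fibre consists of two circles, which swapping the two entries
  interchanges, and over the boundary the entries agree up to sign, so that a pair meets its swap or
  the negative of its swap. The second pair can follow because the sum of squares of the two pairs
  together has norm at most 2.
\<close>

section \<open>Path components\<close>

lemma path_componentI:
  fixes g :: "real \<Rightarrow> 'a::topological_space"
  assumes "continuous_on {0..1} g" "\<And>t. t \<in> {0..1} \<Longrightarrow> g t \<in> S" "g 0 = x" "g 1 = y"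
  shows "path_component S x y"
  unfolding path_component_def path_def path_image_def pathstart_def pathfinish_def
  using assms by (intro exI[of _ g]) auto

lemma path_component_image:
  fixes f :: "'a::topological_space \<Rightarrow> 'b::topological_space"
  assumes "path_component S x y" "continuous_on S f" "f ` S \<subseteq> T"
  shows "path_component T (f x) (f y)"
proof -
  obtain g where g: "path g" "path_image g \<subseteq> S" "pathstart g = x" "pathfinish g = y"
    using assms(1) unfolding path_component_def by blast
  have "path (f \<circ> g)"
    using g assms(2) by (meson continuous_on_subset path_continuous_image)
  moreover have "path_image (f \<circ> g) \<subseteq> T"
    using g(2) assms(3) by (auto simp: path_image_compose)
  ultimately show ?thesis
    using g(3,4) unfolding path_component_def
    by (intro exI[of _ "f \<circ> g"]) (simp add: pathstart_compose pathfinish_compose)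
qed

section \<open>Pairs of unit complex numbers and the sum of their squares\<close>

text \<open>
  The torus of pairs of unit complex numbers.
\<close>
definition unit_pairs :: "(complex \<times> complex) set" where
  "unit_pairs = {z. norm (fst z) = 1 \<and> norm (snd z) = 1}"

text \<open>
  The map from the torus of unit pairs to the disc of radius 2 whose path lifting drives the argument.
\<close>
definition sqsum :: "complex \<times> complex \<Rightarrow> complex" where
  "sqsum z = (fst z)\<^sup>2 + (snd z)\<^sup>2"

text \<open>
  The time scale of all lifted segments: it rests at 0 on the interval from 0 to 1/2 and then runs
  linearly to 1.
  The rest period is used only by pairs with vanishing sum of squares, which must be rotated before
  their sum of squares can move in a prescribed direction. A time scale common to all pairs lets
  several segments be lifted at once while the total sum of squares stays constant.
\<close>
definition delayed :: "real \<Rightarrow> real" where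
  "delayed t = max 0 (2 * t - 1)"

lemma delayed_bounds: "t \<in> {0..1} \<Longrightarrow> delayed t \<in> {0..1}"
  and delayed_0 [simp]: "delayed 0 = 0"
  and delayed_1 [simp]: "delayed 1 = 1"
  by (auto simp: delayed_def)

lemma continuous_on_delayed [continuous_intros]: "continuous_on A delayed"
  unfolding delayed_def by (intro continuous_intros)

lemma sqsum_uminus [simp]: "sqsum (- z) = sqsum z"
  by (simp add: sqsum_def)

lemma sqsum_swap [simp]: "sqsum (prod.swap z) = sqsum z"
  by (simp add: sqsum_def)

lemma unit_pairs_uminus [simp]: "- z \<in> unit_pairs \<longleftrightarrow> z \<in> unit_pairs"
  by (simp add: unit_pairs_def)

lemma unit_pairs_swap [simp]: "prod.swap z \<in> unit_pairs \<longleftrightarrow> z \<in> unit_pairs"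
  by (auto simp: unit_pairs_def)

lemma norm_sqsum_le: "z \<in> unit_pairs \<Longrightarrow> norm (sqsum z) \<le> 2"
  unfolding sqsum_def unit_pairs_def
  using norm_triangle_ineq[of "(fst z)\<^sup>2" "(snd z)\<^sup>2"] by (simp add: norm_power)

lemma norm_segment_le:
  fixes p q :: "'a::real_normed_vector"
  assumes "norm p \<le> r" "norm q \<le> r" "t \<in> {0..1}"
  shows "norm ((1 - t) *\<^sub>R p + t *\<^sub>R q) \<le> r"
proof -
  have "(1 - t) *\<^sub>R p + t *\<^sub>R q \<in> cball 0 r"
    by (rule convexD[OF convex_cball]) (use assms in auto)
  then show ?thesis by simp
qed

section \<open>Lifting segments to unit pairs\<close>

text \<open>
  A segment starting at the point with signed polar coordinates \<open>2 * c\<^sub>0\<close> and \<open>2 * \<theta>\<^sub>0\<close> lifts to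
  continuous polar coordinates. The radius is allowed to be negative, so a segment that crosses the
  origin lifts with a constant angle.
\<close>
lemma polar_segment_lift:
  fixes q :: complex and \<theta>\<^sub>0 c\<^sub>0 :: real
  obtains \<theta> c :: "real \<Rightarrow> real"
  where "continuous_on {0..1} \<theta>" "continuous_on {0..1} c" "\<theta> 0 = \<theta>\<^sub>0" "c 0 = c\<^sub>0"
    "\<And>t. t \<in> {0..1} \<Longrightarrow> of_real (2 * c t) * cis (2 * \<theta> t) =
       (1 - delayed t) *\<^sub>R (of_real (2 * c\<^sub>0) * cis (2 * \<theta>\<^sub>0)) + delayed t *\<^sub>R q"
proof (cases "c\<^sub>0 = 0")
  case True
  \<comment> \<open>First turn at the origin towards \<open>q\<close>, then move radially.\<close>
  define \<theta> where "\<theta> t = \<theta>\<^sub>0 + min 1 (2 * t) * (Arg q / 2 - \<theta>\<^sub>0)" for t :: real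
  define c where "c t = delayed t * (norm q / 2)" for t :: real
  show ?thesis
  proof (rule that[of \<theta> c])
    show "continuous_on {0..1} \<theta>" "continuous_on {0..1} c"
      unfolding \<theta>_def c_def by (intro continuous_intros)+
    show "\<theta> 0 = \<theta>\<^sub>0" "c 0 = c\<^sub>0"
      using True by (auto simp: \<theta>_def c_def)
    show "of_real (2 * c t) * cis (2 * \<theta> t) =
       (1 - delayed t) *\<^sub>R (of_real (2 * c\<^sub>0) * cis (2 * \<theta>\<^sub>0)) + delayed t *\<^sub>R q" for t
    proof (cases "t \<le> 1/2")
      case half: True
      then show ?thesis using True by (simp add: c_def delayed_def)
    next
      case half: False
      have "2 * \<theta> t = Arg q" using half by (simp add: \<theta>_def)
      moreover have "norm q * cis (Arg q) = q"
        using rcis_cmod_Arg[of q] by (simp add: rcis_def)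
      ultimately show ?thesis using True
        by (simp add: c_def scaleR_conv_of_real algebra_simps)
    qed
  qed
next
  case False
  define p where "p = of_real (2 * c\<^sub>0) * cis (2 * \<theta>\<^sub>0)"
  have p0: "p \<noteq> 0" using False by (simp add: p_def cis_neq_zero)
  define w where "w = q / p"
  \<comment> \<open>The segment is \<open>p * h t\<close>: unless \<open>q\<close> is a nonpositive multiple of \<open>p\<close>, the factor \<open>h\<close>
      avoids the branch cut of the logarithm.\<close>
  define h where "h t = 1 + delayed t * (w - 1)" for t :: real
  have ph: "p * h t = (1 - delayed t) *\<^sub>R p + delayed t *\<^sub>R q" for t
    using p0 by (simp add: h_def w_def scaleR_conv_of_real field_simps)
  have conth: "continuous_on {0..1} h"
    unfolding h_def by (intro continuous_intros)
  show ?thesis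
  proof (cases "w \<in> \<real>\<^sub>\<le>\<^sub>0")
    case True
    then obtain r where r: "w = of_real r" by (auto elim: nonpos_Reals_cases)
    show ?thesis
    proof (rule that[of "\<lambda>_. \<theta>\<^sub>0" "\<lambda>t. c\<^sub>0 * (1 + delayed t * (r - 1))"])
      show "continuous_on {0..1} (\<lambda>t. c\<^sub>0 * (1 + delayed t * (r - 1)))"
        by (intro continuous_intros)
      show "of_real (2 * (c\<^sub>0 * (1 + delayed t * (r - 1)))) * cis (2 * \<theta>\<^sub>0) =
         (1 - delayed t) *\<^sub>R (of_real (2 * c\<^sub>0) * cis (2 * \<theta>\<^sub>0)) + delayed t *\<^sub>R q" for t
        using ph[of t] unfolding h_def r p_def by (simp add: algebra_simps)
    qed auto
  next
    case w: False
    have hpos: "h t \<notin> \<real>\<^sub>\<le>\<^sub>0" if "t \<in> {0..1}" for t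
    proof
      assume a: "h t \<in> \<real>\<^sub>\<le>\<^sub>0"
      define s where "s = delayed t"
      have s: "0 \<le> s" "s \<le> 1" using delayed_bounds[OF that] by (auto simp: s_def)
      have re: "1 + s * (Re w - 1) \<le> 0" and im: "s * Im w = 0"
        using a by (auto simp: h_def s_def complex_nonpos_Reals_iff)
      have "s \<noteq> 0" using re by auto
      then have "Im w = 0" using im by simp
      moreover have "s * Re w \<le> 0" using re s by (simp add: algebra_simps)
      then have "Re w \<le> 0" using s \<open>s \<noteq> 0\<close> by (simp add: mult_le_0_iff)
      ultimately show False using w by (simp add: complex_nonpos_Reals_iff)
    qed
    show ?thesis
    proof (rule that[of "\<lambda>t. \<theta>\<^sub>0 + Im (Ln (h t)) / 2" "\<lambda>t. c\<^sub>0 * norm (h t)"])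
      show "continuous_on {0..1} (\<lambda>t. \<theta>\<^sub>0 + Im (Ln (h t)) / 2)"
        using hpos conth by (intro continuous_intros) auto
      show "continuous_on {0..1} (\<lambda>t. c\<^sub>0 * norm (h t))"
        using conth by (intro continuous_intros)
      show "of_real (2 * (c\<^sub>0 * norm (h t))) * cis (2 * (\<theta>\<^sub>0 + Im (Ln (h t)) / 2)) =
         (1 - delayed t) *\<^sub>R (of_real (2 * c\<^sub>0) * cis (2 * \<theta>\<^sub>0)) + delayed t *\<^sub>R q"
        if "t \<in> {0..1}" for t
      proof -
        have "h t \<noteq> 0" using hpos[OF that] by auto
        then have "norm (h t) * cis (Im (Ln (h t))) = h t"
          using rcis_cmod_Arg[of "h t"] by (simp add: rcis_def Arg_def)
        then have "of_real (2 * (c\<^sub>0 * norm (h t))) * cis (2 * \<theta>\<^sub>0 + Im (Ln (h t))) = p * h t"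
          by (simp add: p_def cis_mult[symmetric] mult_ac)
        then show ?thesis
          using ph[of t] by (simp only: p_def distrib_left) simp
      qed
    qed (auto simp: h_def)
  qed
qed

lemma cos_lift:
  fixes c :: "real \<Rightarrow> real"
  assumes "continuous_on A c" "\<And>t. t \<in> A \<Longrightarrow> \<bar>c t\<bar> \<le> 1" "a \<in> A" "c a = cos \<psi>\<^sub>0"
  obtains \<psi> where "continuous_on A \<psi>" "\<psi> a = \<psi>\<^sub>0" "\<And>t. t \<in> A \<Longrightarrow> cos (\<psi> t) = c t"
proof -
  obtain k :: int where
    "\<psi>\<^sub>0 = arccos (c a) + 2 * k * pi \<or> \<psi>\<^sub>0 = - arccos (c a) + 2 * k * pi"
    using cos_eq_arccos_Ex[of \<psi>\<^sub>0 "c a"] assms(4) by auto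
  then have "\<exists>s::real. (s = 1 \<or> s = -1) \<and> \<psi>\<^sub>0 = s * arccos (c a) + k * (2 * pi)"
    by (elim disjE; intro exI[of _ "if \<psi>\<^sub>0 = arccos (c a) + 2 * k * pi then 1 else -1"]) auto
  then obtain s :: real where s: "s = 1 \<or> s = -1" "\<psi>\<^sub>0 = s * arccos (c a) + k * (2 * pi)"
    by blast
  show ?thesis
  proof (rule that[of "\<lambda>t. s * arccos (c t) + k * (2 * pi)"])
    show "continuous_on A (\<lambda>t. s * arccos (c t) + k * (2 * pi))"
      using assms(1,2) by (intro continuous_intros) (auto simp: abs_le_iff)
    show "cos (s * arccos (c t) + k * (2 * pi)) = c t" if "t \<in> A" for t
      using s(1) assms(2)[OF that] cos.plus_of_int[of "s * arccos (c t)" k]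
      by (auto simp: abs_le_iff)
  qed (use s in auto)
qed

lemma sqsum_cis: "sqsum (cis (\<theta> + \<phi>), cis (\<theta> - \<phi>)) = of_real (2 * cos (2 * \<phi>)) * cis (2 * \<theta>)"
proof -
  have "sqsum (cis (\<theta> + \<phi>), cis (\<theta> - \<phi>)) = cis (2 * \<theta>) * (cis (2 * \<phi>) + cis (- (2 * \<phi>)))"
    by (simp add: sqsum_def power2_eq_square cis_mult algebra_simps)
  also have "cis (2 * \<phi>) + cis (- (2 * \<phi>)) = of_real (2 * cos (2 * \<phi>))"
    by (simp add: complex_eq_iff)
  finally show ?thesis by simp
qed

text \<open>
  By \<open>sqsum_cis\<close>, the half sum and the half difference of the two arguments of a unit pair determine the
  polar angle and the signed radius of its sum of squares; the former is lifted by
  \<open>polar_segment_lift\<close>, the latter by an arc cosine.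
\<close>
lemma unit_pair_segment_lift:
  assumes z: "z \<in> unit_pairs" and q: "norm q \<le> 2"
  obtains g where "continuous_on {0..1} g" "g 0 = z" "\<And>t. t \<in> {0..1} \<Longrightarrow> g t \<in> unit_pairs"
    "\<And>t. t \<in> {0..1} \<Longrightarrow> sqsum (g t) = (1 - delayed t) *\<^sub>R sqsum z + delayed t *\<^sub>R q"
proof -
  define \<alpha> \<beta> where "\<alpha> = Arg (fst z)" and "\<beta> = Arg (snd z)"
  define \<theta>\<^sub>0 \<phi>\<^sub>0 where "\<theta>\<^sub>0 = (\<alpha> + \<beta>) / 2" and "\<phi>\<^sub>0 = (\<alpha> - \<beta>) / 2"
  have "z = (cis \<alpha>, cis \<beta>)"
    using z rcis_cmod_Arg[of "fst z"] rcis_cmod_Arg[of "snd z"]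
    by (simp add: unit_pairs_def \<alpha>_def \<beta>_def rcis_def prod_eq_iff)
  then have z_eq: "z = (cis (\<theta>\<^sub>0 + \<phi>\<^sub>0), cis (\<theta>\<^sub>0 - \<phi>\<^sub>0))"
    by (simp add: \<theta>\<^sub>0_def \<phi>\<^sub>0_def diff_divide_distrib add_divide_distrib)
  have sq_z: "sqsum z = of_real (2 * cos (2 * \<phi>\<^sub>0)) * cis (2 * \<theta>\<^sub>0)"
    using sqsum_cis z_eq by simp
  obtain \<theta> c where \<theta>: "continuous_on {0..1} \<theta>" "\<theta> 0 = \<theta>\<^sub>0"
    and c: "continuous_on {0..1} c" "c 0 = cos (2 * \<phi>\<^sub>0)"
    and seg: "\<And>t. t \<in> {0..1} \<Longrightarrow> of_real (2 * c t) * cis (2 * \<theta> t) =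
       (1 - delayed t) *\<^sub>R sqsum z + delayed t *\<^sub>R q"
    using polar_segment_lift[of \<theta>\<^sub>0 "cos (2 * \<phi>\<^sub>0)" q] unfolding sq_z by metis
  have "\<bar>c t\<bar> \<le> 1" if "t \<in> {0..1}" for t
  proof -
    have "norm (of_real (2 * c t) * cis (2 * \<theta> t)) \<le> 2"
      unfolding seg[OF that]
      using norm_segment_le[OF norm_sqsum_le[OF z] q delayed_bounds[OF that]] .
    then show ?thesis by (simp add: norm_mult)
  qed
  then obtain \<psi> where \<psi>: "continuous_on {0..1} \<psi>" "\<psi> 0 = 2 * \<phi>\<^sub>0"
    "\<And>t. t \<in> {0..1} \<Longrightarrow> cos (\<psi> t) = c t"
    using cos_lift[of "{0..1}" c 0 "2 * \<phi>\<^sub>0"] c by auto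
  show ?thesis
  proof (rule that[of "\<lambda>t. (cis (\<theta> t + \<psi> t / 2), cis (\<theta> t - \<psi> t / 2))"])
    show "continuous_on {0..1} (\<lambda>t. (cis (\<theta> t + \<psi> t / 2), cis (\<theta> t - \<psi> t / 2)))"
      using \<theta>(1) \<psi>(1) unfolding cis_conv_exp by (intro continuous_intros) auto
    show "(cis (\<theta> 0 + \<psi> 0 / 2), cis (\<theta> 0 - \<psi> 0 / 2)) = z"
      using \<theta>(2) \<psi>(2) z_eq by simp
    show "sqsum (cis (\<theta> t + \<psi> t / 2), cis (\<theta> t - \<psi> t / 2)) =
      (1 - delayed t) *\<^sub>R sqsum z + delayed t *\<^sub>R q" if "t \<in> {0..1}" for t
      using sqsum_cis[of "\<theta> t" "\<psi> t / 2"] \<psi>(3)[OF that] seg[OF that] by simp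
  qed (simp add: unit_pairs_def)
qed

section \<open>Exchanging one of two pairs\<close>

text \<open>
  Quadruples of unit complex numbers, grouped into two pairs, with prescribed sum of squares \<open>s\<close>.
\<close>
definition two_pairs :: "complex \<Rightarrow> ((complex \<times> complex) \<times> (complex \<times> complex)) set" where
  "two_pairs s = {(a, b). a \<in> unit_pairs \<and> b \<in> unit_pairs \<and> sqsum a + sqsum b = s}"

text \<open>
  The unit pairs with sum of squares \<open>q\<close>.
\<close>
definition pair_fibre :: "complex \<Rightarrow> (complex \<times> complex) set" where
  "pair_fibre q = {z \<in> unit_pairs. sqsum z = q}"

text \<open>
  The path \<open>g\<close> of unit pairs starts at \<open>a\<close>, and its sums of squares run along the segment from that
  of \<open>a\<close> to \<open>q\<close>, on the delayed time scale.
\<close>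
definition lifts_to :: "complex \<Rightarrow> (complex \<times> complex) \<Rightarrow> (real \<Rightarrow> complex \<times> complex) \<Rightarrow> bool" where
  "lifts_to q a g \<longleftrightarrow> continuous_on {0..1} g \<and> g 0 = a \<and>
     (\<forall>t\<in>{0..1}. g t \<in> pair_fibre ((1 - delayed t) *\<^sub>R sqsum a + delayed t *\<^sub>R q))"

lemma lifts_to_exists:
  assumes "a \<in> unit_pairs" "norm q \<le> 2"
  obtains g where "lifts_to q a g"
proof -
  obtain g where "continuous_on {0..1} g" "g 0 = a" "\<And>t. t \<in> {0..1} \<Longrightarrow> g t \<in> unit_pairs"
    "\<And>t. t \<in> {0..1} \<Longrightarrow> sqsum (g t) = (1 - delayed t) *\<^sub>R sqsum a + delayed t *\<^sub>R q"
    using unit_pair_segment_lift[OF assms] by metis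
  then show ?thesis
    by (intro that[of g]) (simp add: lifts_to_def pair_fibre_def)
qed

lemma lifts_to_end: "lifts_to q a g \<Longrightarrow> g 1 \<in> pair_fibre q"
  unfolding lifts_to_def
  by (elim conjE, drule bspec[of _ _ 1]) simp_all

lemma lifts_to_uminus: "lifts_to q a g \<Longrightarrow> lifts_to q (- a) (\<lambda>t. - g t)"
  by (simp add: lifts_to_def pair_fibre_def continuous_on_minus)

lemma lifts_to_swap:
  assumes "lifts_to q a g"
  shows "lifts_to q (prod.swap a) (\<lambda>t. prod.swap (g t))"
proof -
  have "continuous_on {0..1} (\<lambda>t. prod.swap (g t))"
    using assms unfolding lifts_to_def prod.swap_def
    by (intro continuous_on_Pair continuous_on_fst continuous_on_snd) simp_all
  then show ?thesis
    using assms by (simp add: lifts_to_def pair_fibre_def)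
qed

text \<open>
  Two pairs \<open>a\<close> and \<open>a'\<close> in the same fibre are moved along the same segment, compensated by one and
  the same motion of \<open>b\<close>. If the end points can be joined in the fibre over \<open>q\<close>, running back shows
  that \<open>a\<close> can be exchanged for \<open>a'\<close> while \<open>b\<close> returns to its initial position.
\<close>
lemma two_pairs_transport:
  assumes b: "(a, b) \<in> two_pairs s" and q: "norm q \<le> 2" "norm (s - q) \<le> 2"
    and g: "lifts_to q a g" and g': "lifts_to q a' g'" and eq: "sqsum a' = sqsum a"
    and end_eq: "path_component (pair_fibre q) (g 1) (g' 1)"
  shows "path_component (two_pairs s) (a, b) (a', b)"
proof -
  obtain h where h: "lifts_to (s - q) b h"
    using lifts_to_exists[OF _ q(2), of b] b by (auto simp: two_pairs_def)
  have s: "sqsum b = s - sqsum a" using b by (auto simp: two_pairs_def algebra_simps)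
  have move: "path_component (two_pairs s) (x, b) (f 1, h 1)"
    if f: "lifts_to q x f" "sqsum x = sqsum a" for x f
  proof (rule path_componentI[of "\<lambda>t. (f t, h t)"])
    show "continuous_on {0..1} (\<lambda>t. (f t, h t))"
      using f(1) h by (auto simp: lifts_to_def intro: continuous_intros)
    show "(f t, h t) \<in> two_pairs s" if "t \<in> {0..1}" for t
    proof -
      have "sqsum (f t) + sqsum (h t) = s"
        using f(1) h that unfolding lifts_to_def pair_fibre_def f(2) s
        by (simp add: scaleR_diff_left scaleR_diff_right)
      then show ?thesis
        using f(1) h that by (simp add: lifts_to_def two_pairs_def pair_fibre_def)
    qed
  qed (use f h in \<open>auto simp: lifts_to_def\<close>)
  have "path_component (two_pairs s) (g 1, h 1) (g' 1, h 1)"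
    by (rule path_component_image[OF end_eq, of "\<lambda>z. (z, h 1)"])
       (use lifts_to_end[OF h] in \<open>auto simp: two_pairs_def pair_fibre_def intro!: continuous_intros\<close>)
  then show ?thesis
    using move[OF g refl] path_component_sym[OF move[OF g' eq]] path_component_trans by blast
qed

text \<open>
  The fibre over 0 consists of two circles, according to whether the ratio of the entries is
  \<open>\<i>\<close> or \<open>- \<i>\<close>; each of them is an orbit of the simultaneous rotation of both entries.
\<close>
lemma pair_fibre_0:
  assumes "z \<in> pair_fibre 0"
  shows "snd z = \<i> * fst z \<or> snd z = - \<i> * fst z"
proof -
  have "(snd z)\<^sup>2 = (\<i> * fst z)\<^sup>2"
    using assms by (simp add: pair_fibre_def sqsum_def power_mult_distrib add_eq_0_iff)
  then show ?thesis by (simp add: power2_eq_iff)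
qed

lemma pair_fibre_0_rotate:
  assumes "z \<in> pair_fibre 0" "z' \<in> pair_fibre 0"
    and "snd z = c * fst z" "snd z' = c * fst z'"
  shows "path_component (pair_fibre 0) z z'"
proof -
  have z: "norm (fst z) = 1" "norm (fst z') = 1" and c: "norm c = 1"
    using assms by (auto simp: pair_fibre_def unit_pairs_def norm_mult)
  have "(1 + c\<^sup>2) * (fst z)\<^sup>2 = 0"
    using assms(1,3) by (simp add: pair_fibre_def sqsum_def power_mult_distrib algebra_simps)
  then have "1 + c\<^sup>2 = 0"
    using z(1) by auto
  then have c2: "u\<^sup>2 + (c * u)\<^sup>2 = 0" for u
    by (metis distrib_right mult_1 mult_zero_left power_mult_distrib)
  have "path_component (sphere 0 1) (fst z) (fst z')"
    using path_connected_sphere[of "0::complex" 1] z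
    by (simp add: path_connected_component)
  then have "path_component (pair_fibre 0) (fst z, c * fst z) (fst z', c * fst z')"
  proof (rule path_component_image)
    show "continuous_on (sphere 0 1) (\<lambda>u. (u, c * u))" by (intro continuous_intros)
    show "(\<lambda>u. (u, c * u)) ` sphere 0 1 \<subseteq> pair_fibre 0"
      using c c2 by (auto simp: pair_fibre_def unit_pairs_def sqsum_def norm_mult)
  qed
  then show ?thesis using assms(3,4) by (metis prod.collapse)
qed

text \<open>
  Moving through the fibre over 0 joins \<open>a\<close> to every pair of its fibre that reaches the same circle
  there, in particular to \<open>- a\<close>, and swapping the entries interchanges the two circles. Moving
  through a point \<open>2 * d\<close> on the boundary of the disc, where the two entries agree up to sign, joins
  \<open>a\<close> to its swap.
\<close>
lemma two_pairs_exchange: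
  assumes ab: "(a, b) \<in> two_pairs s" and s: "norm s \<le> 2"
    and a': "a' \<in> unit_pairs" "sqsum a' = sqsum a"
  shows "path_component (two_pairs s) (a, b) (a', b)"
proof -
  have mem: "(x, b) \<in> two_pairs s" if "x \<in> unit_pairs" "sqsum x = sqsum a" for x
    using that ab by (auto simp: two_pairs_def)
  have a: "a \<in> unit_pairs" using ab by (auto simp: two_pairs_def)
  have neg: "path_component (two_pairs s) (x, b) (- x, b)"
    if x: "x \<in> unit_pairs" "sqsum x = sqsum a" for x
  proof -
    obtain g where g: "lifts_to 0 x g" using lifts_to_exists[OF x(1), of 0] by auto
    have e: "g 1 \<in> pair_fibre 0" "- g 1 \<in> pair_fibre 0"
      using lifts_to_end[OF g] by (auto simp: pair_fibre_def)
    obtain c where "snd (g 1) = c * fst (g 1)"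
      using pair_fibre_0[OF e(1)] by blast
    then have "path_component (pair_fibre 0) (g 1) (- g 1)"
      by (intro pair_fibre_0_rotate[OF e, of c]) simp_all
    then show ?thesis
      by (intro two_pairs_transport[OF mem[OF x] _ _ g lifts_to_uminus[OF g]]) (use s in simp_all)
  qed
  have swap: "path_component (two_pairs s) (a, b) (prod.swap a, b)"
  proof -
    \<comment> \<open>The choice of \<open>d\<close> keeps both \<open>2 * d\<close> and \<open>s - 2 * d\<close> in the disc of radius 2.\<close>
    define d where "d = (if s = 0 then 1 else sgn s)"
    have d: "norm d = 1" by (simp add: d_def norm_sgn)
    have "s - 2 * d = complex_of_real (norm s - 2) * d"
    proof (cases "s = 0")
      case False
      then have "s = norm s * d" by (simp add: d_def sgn_eq)
      then show ?thesis by (simp add: algebra_simps)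
    qed (simp add: d_def)
    then have sd: "norm (s - 2 * d) \<le> 2"
      using s d by (simp add: norm_mult del: of_real_diff)
    obtain g where g: "lifts_to (2 * d) a g"
      using lifts_to_exists[OF a, of "2 * d"] d by (auto simp: norm_mult)
    have e: "g 1 \<in> pair_fibre (2 * d)" using lifts_to_end[OF g] .
    have n: "norm (2 * d) \<le> 2" using d by (simp add: norm_mult)
    obtain u v where uv: "g 1 = (u, v)" by force
    have uv1: "norm u = 1" "norm v = 1" "u\<^sup>2 + v\<^sup>2 = 2 * d"
      using e uv by (auto simp: pair_fibre_def unit_pairs_def sqsum_def)
    \<comment> \<open>Equality in the triangle inequality: two unit numbers whose sum has norm 2 coincide.\<close>
    have "u\<^sup>2 = v\<^sup>2"
    proof -
      have "norm (u\<^sup>2 + v\<^sup>2) = norm (u\<^sup>2) + norm (v\<^sup>2)"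
        unfolding uv1(3) using uv1 d by (simp add: norm_mult norm_power)
      then have "norm (u\<^sup>2) *\<^sub>R v\<^sup>2 = norm (v\<^sup>2) *\<^sub>R u\<^sup>2"
        using norm_triangle_eq by blast
      then show ?thesis using uv1 by (simp add: norm_power)
    qed
    then have cases: "prod.swap (g 1) = g 1 \<or> prod.swap (g 1) = - g 1"
      using uv by (auto simp: power2_eq_iff)
    then show ?thesis
    proof
      assume "prod.swap (g 1) = g 1"
      then show ?thesis
        using two_pairs_transport[OF ab n sd g lifts_to_swap[OF g]] e
        by (simp add: path_component_refl)
    next
      assume "prod.swap (g 1) = - g 1"
      then have "path_component (two_pairs s) (a, b) (- prod.swap a, b)"
        using two_pairs_transport[OF ab n sd g lifts_to_uminus[OF lifts_to_swap[OF g]]] e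
        by (simp add: path_component_refl)
      moreover have "path_component (two_pairs s) (- prod.swap a, b) (prod.swap a, b)"
        by (rule path_component_sym, rule neg) (use a in simp_all)
      ultimately show ?thesis by (rule path_component_trans)
    qed
  qed
  obtain g where g: "lifts_to 0 a g" using lifts_to_exists[OF a, of 0] by auto
  obtain g' where g': "lifts_to 0 a' g'" using lifts_to_exists[OF a'(1), of 0] by auto
  note e = lifts_to_end[OF g] and e' = lifts_to_end[OF g']
  have es: "prod.swap (g 1) \<in> pair_fibre 0" using e by (auto simp: pair_fibre_def)
  obtain c where c: "c = \<i> \<or> c = - \<i>" "snd (g' 1) = c * fst (g' 1)"
    using pair_fibre_0[OF e'] that by blast
  have "snd (g 1) = c * fst (g 1) \<or> snd (prod.swap (g 1)) = c * fst (prod.swap (g 1))"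
    using pair_fibre_0[OF e] c(1) by (elim disjE) simp_all
  then show ?thesis
  proof
    assume "snd (g 1) = c * fst (g 1)"
    from pair_fibre_0_rotate[OF e e' this c(2)] show ?thesis
      by (intro two_pairs_transport[OF ab _ _ g g' a'(2)]) (use s in simp_all)
  next
    assume "snd (prod.swap (g 1)) = c * fst (prod.swap (g 1))"
    from pair_fibre_0_rotate[OF es e' this c(2)]
    have "path_component (two_pairs s) (prod.swap a, b) (a', b)"
      by (intro two_pairs_transport[OF mem _ _ lifts_to_swap[OF g] g']) (use s a a' in simp_all)
    with swap show ?thesis by (rule path_component_trans)
  qed
qed

section \<open>The configuration space of all pairs\<close>

text \<open>
  Lists of unit complex numbers subject to one equation on their squares, encoded as \<open>m\<close> pairs
  together with a single number \<open>c\<close> whose square has weight \<open>e\<close>. Weight 1 describes the lists of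
  length \<open>2 * m + 1\<close> with vanishing sum of squares, and weight 0 those of length \<open>2 * m\<close>, with a free
  unit number \<open>c\<close> in addition. Positions from \<open>m\<close> on carry the default value 0.
\<close>
definition configs :: "nat \<Rightarrow> complex \<Rightarrow> ((nat \<Rightarrow> complex \<times> complex) \<times> complex) set" where
  "configs m e = {(x, c). (\<forall>j<m. x j \<in> unit_pairs) \<and> (\<forall>j\<ge>m. x j = 0) \<and> norm c = 1 \<and>
     e * c\<^sup>2 + (\<Sum>j<m. sqsum (x j)) = 0}"

text \<open>
  All sums of squares of the pairs move simultaneously along segments to their common mean; as
  these segments run on one time scale, the total is constant.
\<close>
lemma configs_balance:
  assumes xc: "(x, c) \<in> configs m e" and m: "m > 0" and e: "norm e \<le> 1"
  obtains x' where "path_component (configs m e) (x, c) (x', c)"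
    "\<And>j. j < m \<Longrightarrow> sqsum (x' j) = - (e * c\<^sup>2) / of_nat m"
proof -
  define q where "q = - (e * c\<^sup>2) / of_nat m"
  have x: "\<And>j. j < m \<Longrightarrow> x j \<in> unit_pairs" "\<And>j. j \<ge> m \<Longrightarrow> x j = 0" and c: "norm c = 1"
    and sum: "(\<Sum>j<m. sqsum (x j)) = - (e * c\<^sup>2)"
    using xc by (auto simp: configs_def eq_neg_iff_add_eq_0 add.commute)
  have "norm q = norm e / real m"
    using c by (simp add: q_def norm_divide norm_mult norm_power)
  also have "\<dots> \<le> 1"
    using m e by simp
  finally have q: "norm q \<le> 2" by simp
  have "\<forall>j. \<exists>g. j < m \<longrightarrow> lifts_to q (x j) g"
    using lifts_to_exists[OF x(1) q] by metis
  then obtain g where g: "\<And>j. j < m \<Longrightarrow> lifts_to q (x j) (g j)"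
    by metis
  define X where "X t j = (if j < m then g j t else 0)" for t j
  show ?thesis
  proof (rule that[of "X 1"])
    show "sqsum (X 1 j) = - (e * c\<^sup>2) / of_nat m" if "j < m" for j
      using lifts_to_end[OF g[OF that]] that by (simp add: X_def pair_fibre_def q_def)
    show "path_component (configs m e) (x, c) (X 1, c)"
    proof (rule path_componentI[of "\<lambda>t. (X t, c)"])
      show "(X 0, c) = (x, c)"
        using g x(2) by (auto simp: X_def lifts_to_def)
      have "continuous_on {0..1} (\<lambda>t. X t j)" for j
        using g[of j] unfolding X_def lifts_to_def by (cases "j < m") simp_all
      then show "continuous_on {0..1} (\<lambda>t. (X t, c))"
        by (intro continuous_on_Pair continuous_on_coordinatewise_then_product continuous_on_const)
      show "(X t, c) \<in> configs m e" if t: "t \<in> {0..1}" for t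
      proof -
        have lift: "X t j \<in> unit_pairs"
          "sqsum (X t j) = (1 - delayed t) *\<^sub>R sqsum (x j) + delayed t *\<^sub>R q" if "j < m" for j
          using g[OF that] t that by (simp_all add: X_def lifts_to_def pair_fibre_def)
        have "(\<Sum>j<m. sqsum (X t j)) =
            (1 - delayed t) *\<^sub>R (\<Sum>j<m. sqsum (x j)) + delayed t *\<^sub>R (of_nat m * q)"
          by (simp add: lift(2) sum.distrib flip: scaleR_sum_right)
        also have "of_nat m * q = - (e * c\<^sup>2)" using m by (simp add: q_def)
        finally have "(\<Sum>j<m. sqsum (X t j)) = - (e * c\<^sup>2)"
          unfolding sum by (simp add: scaleR_diff_left)
        then show ?thesis using lift(1) c by (simp add: configs_def X_def)
      qed
    qed simp
  qed
qed

lemma configs_rotate: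
  assumes xc: "(x, c) \<in> configs m e" and u: "norm u = 1"
  shows "path_component (configs m e) (x, c) (\<lambda>j. (u * fst (x j), u * snd (x j)), u * c)"
proof -
  define R where "R v = (\<lambda>j. (v * fst (x j), v * snd (x j)), v * c)" for v
  have "path_component (sphere 0 1) 1 u"
    using path_connected_sphere[of "0::complex" 1] u by (simp add: path_connected_component)
  then have "path_component (configs m e) (R 1) (R u)"
  proof (rule path_component_image)
    show "continuous_on (sphere 0 1) R"
      unfolding R_def
      by (intro continuous_on_Pair continuous_on_coordinatewise_then_product continuous_intros)
    show "R ` sphere 0 1 \<subseteq> configs m e"
    proof (rule image_subsetI)
      fix v :: complex assume v: "v \<in> sphere 0 1"
      have "sqsum (v * fst z, v * snd z) = v\<^sup>2 * sqsum z" for z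
        by (simp add: sqsum_def power_mult_distrib distrib_left)
      then have "e * (v * c)\<^sup>2 + (\<Sum>j<m. sqsum (v * fst (x j), v * snd (x j))) =
          v\<^sup>2 * (e * c\<^sup>2 + (\<Sum>j<m. sqsum (x j)))"
        by (simp add: power_mult_distrib distrib_left sum_distrib_left)
      then show "R v \<in> configs m e"
        using xc v by (simp add: configs_def R_def unit_pairs_def norm_mult zero_prod_def)
    qed
  qed
  then show ?thesis by (simp add: R_def)
qed

lemma configs_replace:
  assumes xc: "(x, c) \<in> configs m e" and jl: "j < m" "l < m" "j \<noteq> l"
    and le: "norm (sqsum (x j) + sqsum (x l)) \<le> 2"
    and a: "a \<in> unit_pairs" "sqsum a = sqsum (x j)"
  shows "path_component (configs m e) (x, c) (x(j := a), c)"
proof -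
  define s where "s = sqsum (x j) + sqsum (x l)"
  have x: "(x j, x l) \<in> two_pairs s"
    using xc jl by (simp add: configs_def two_pairs_def s_def)
  define F where "F z = (x(j := fst z, l := snd z), c)" for z
  have "path_component (configs m e) (F (x j, x l)) (F (a, x l))"
  proof (rule path_component_image[where f = F, OF two_pairs_exchange[OF x _ a]])
    show "norm s \<le> 2" using le by (simp add: s_def)
    have "continuous_on (two_pairs s) (\<lambda>z. (x(j := fst z, l := snd z)) i)" for i
      using jl(3) by (cases "i = l"; cases "i = j") (simp_all add: continuous_on_fst continuous_on_snd)
    then show "continuous_on (two_pairs s) F"
      unfolding F_def
      by (intro continuous_on_Pair continuous_on_coordinatewise_then_product continuous_on_const)
    show "F ` two_pairs s \<subseteq> configs m e"
    proof (rule image_subsetI)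
      fix z assume z: "z \<in> two_pairs s"
      obtain p q where z_eq: "z = (p, q)" by (metis surj_pair)
      have pq: "p \<in> unit_pairs" "q \<in> unit_pairs" "sqsum p + sqsum q = s"
        using z by (simp_all add: z_eq two_pairs_def)
      have split: "(\<Sum>i<m. sqsum (y i)) =
          sqsum (y j) + sqsum (y l) + (\<Sum>i\<in>{..<m} - {j} - {l}. sqsum (y i))"
        for y
        using jl by (simp add: sum.remove[of "{..<m}" j] sum.remove[of "{..<m} - {j}" l] add.assoc)
      have "(\<Sum>i<m. sqsum ((x(j := p, l := q)) i)) = (\<Sum>i<m. sqsum (x i))"
        unfolding split using pq(3) jl(3) by (simp add: s_def)
      then show "F z \<in> configs m e"
        using xc pq(1,2) jl by (simp add: z_eq configs_def F_def)
    qed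
  qed
  moreover have "F (x j, x l) = (x, c)" "F (a, x l) = (x(j := a), c)"
    using jl(3) by (auto simp: F_def)
  ultimately show ?thesis by simp
qed

lemma path_connected_configs:
  assumes m: "m \<ge> 2" and e: "norm e \<le> 1"
  shows "path_connected (configs m e)"
proof -
  define q where "q = - e / of_nat m"
  \<comment> \<open>The standard configurations have \<open>c = 1\<close> and equal sums of squares for all pairs.\<close>
  define standard where "standard x \<longleftrightarrow> (x, 1) \<in> configs m e \<and> (\<forall>j<m. sqsum (x j) = q)" for x
  have std: "\<exists>y. standard y \<and> path_component (configs m e) z (y, 1)" if z: "z \<in> configs m e" for z
  proof -
    obtain x c where xc: "z = (x, c)" by force
    define u where "u = inverse c"
    have c: "norm c = 1" using z xc by (simp add: configs_def)
    then have u: "norm u = 1" "u * c = 1"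
      unfolding u_def by (auto simp: norm_inverse intro!: left_inverse)
    obtain y where y: "path_component (configs m e) z (y, 1)"
      using configs_rotate[OF z[unfolded xc] u(1)] u(2) xc by auto
    then have "(y, 1) \<in> configs m e" by (rule path_component_mem)
    then obtain y' where y': "path_component (configs m e) (y, 1) (y', 1)"
      "\<And>j. j < m \<Longrightarrow> sqsum (y' j) = q"
      using configs_balance[of y 1 m e] m e by (auto simp: q_def)
    then show ?thesis
      using path_component_mem(2)[OF y'(1)] path_component_trans[OF y y'(1)]
      by (auto simp: standard_def)
  qed
  have "norm q \<le> 1"
    using m e by (simp add: q_def norm_divide)
  then have qq: "norm (q + q) \<le> 2"
    using norm_triangle_ineq[of q q] by simp
  have join: "path_component (configs m e) (x, 1) (y, 1)" if "standard x" "standard y" for x y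
  proof -
    \<comment> \<open>Replace the pairs of \<open>x\<close> by those of \<open>y\<close> one at a time.\<close>
    define w where "w n = (\<lambda>j. if j < n then y j else x j)" for n
    have std_w: "standard (w n)" for n
    proof -
      have sq: "sqsum (w n j) = q" if "j < m" for j
        using that \<open>standard x\<close> \<open>standard y\<close> by (simp add: standard_def w_def)
      have "(\<Sum>j<m. sqsum (w n j)) = (\<Sum>j<m. sqsum (x j))"
        using \<open>standard x\<close> by (intro sum.cong) (simp_all add: sq standard_def)
      then show ?thesis
        using \<open>standard x\<close> \<open>standard y\<close> sq by (auto simp: standard_def configs_def w_def)
    qed
    have "path_component (configs m e) (x, 1) (w n, 1)" if "n \<le> m" for n
      using that
    proof (induction n)
      case 0
      then show ?case
        using \<open>standard x\<close> by (simp add: w_def standard_def path_component_refl)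
    next
      case (Suc n)
      \<comment> \<open>The compensating pair can be any other one; here \<open>m \<ge> 2\<close> is needed.\<close>
      define l where "l = (if n = 0 then 1 else 0 :: nat)"
      have l: "l < m" "n \<noteq> l" using m by (auto simp: l_def)
      have n: "n < m" using Suc.prems by simp
      have "path_component (configs m e) (w n, 1) ((w n)(n := y n), 1)"
      proof (rule configs_replace[OF _ n l])
        show "(w n, 1) \<in> configs m e" using std_w by (simp add: standard_def)
        show "norm (sqsum (w n n) + sqsum (w n l)) \<le> 2"
          using std_w n l(1) qq by (simp add: standard_def)
        show "y n \<in> unit_pairs" "sqsum (y n) = sqsum (w n n)"
          using \<open>standard y\<close> std_w n by (auto simp: standard_def configs_def)
      qed
      moreover have "(w n)(n := y n) = w (Suc n)"
        by (auto simp: w_def fun_eq_iff less_Suc_eq)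
      ultimately show ?case
        using Suc path_component_trans by (metis Suc_leD)
    qed
    from this[of m] have "path_component (configs m e) (x, 1) (w m, 1)" by simp
    moreover have "w m = y"
      using \<open>standard x\<close> \<open>standard y\<close> by (auto simp: w_def standard_def configs_def fun_eq_iff)
    ultimately show ?thesis by simp
  qed
  show ?thesis
    unfolding path_connected_component
  proof (intro ballI)
    fix z z' assume "z \<in> configs m e" "z' \<in> configs m e"
    then obtain y y' where y: "standard y" "path_component (configs m e) z (y, 1)"
      and y': "standard y'" "path_component (configs m e) z' (y', 1)"
      using std by blast
    have "path_component (configs m e) z (y', 1)"
      using y(2) join[OF y(1) y'(1)] by (rule path_component_trans)
    then show "path_component (configs m e) z z'"
      using path_component_sym[OF y'(2)] by (rule path_component_trans)
  qed
qed

section \<open>Planar tight frames as lists of unit complex numbers\<close>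

text \<open>
  The identification of the complex plane with the Euclidean plane.
\<close>
definition vec_of :: "complex \<Rightarrow> real ^ 2" where
  "vec_of z = (\<chi> i. if i = 1 then Re z else Im z)"

lemma vec_of_components [simp]: "vec_of z $ 1 = Re z" "vec_of z $ 2 = Im z"
  by (simp_all add: vec_of_def)

lemma norm_vec_of [simp]: "norm (vec_of z) = norm z"
  by (simp add: norm_vec_def L2_set_def sum_2 cmod_def)

lemma continuous_on_vec_of [continuous_intros]:
  assumes "continuous_on A f"
  shows "continuous_on A (\<lambda>t. vec_of (f t))"
  unfolding vec_of_def
proof (rule continuous_on_vec_lambda)
  show "continuous_on A (\<lambda>t. if i = 1 then Re (f t) else Im (f t))" for i :: 2
    using assms by (cases "i = 1") (simp_all add: continuous_intros)
qed

lemma surj_vec_of: "\<exists>z. v = vec_of z"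
  by (intro exI[of _ "Complex (v $ 1) (v $ 2)"]) (simp add: vec_eq_iff forall_2)

lemma inner_vec_of_squared:
  "(vec_of w \<bullet> vec_of z)\<^sup>2 = ((norm w)\<^sup>2 * (norm z)\<^sup>2 + Re ((cnj w)\<^sup>2 * z\<^sup>2)) / 2"
  unfolding cmod_power2
  by (simp add: inner_vec_def sum_2 power2_eq_square) (simp add: algebra_simps)

text \<open>
  With \<open>w\<close> representing \<open>v\<close>, the frame sum at \<open>v\<close> is half of the number of vectors times the squared
  norm of \<open>w\<close>, plus half of the real part of \<open>(cnj w)\<^sup>2 * S\<close> where \<open>S\<close> is the sum of the squares. The
  second term is a multiple of the squared norm for all \<open>w\<close> only if \<open>S\<close> vanishes.
\<close>
lemma tight_iff_sum_squares_0:
  fixes z :: "nat \<Rightarrow> complex"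
  assumes z: "\<And>i. i < k \<Longrightarrow> norm (z i) = 1" and k: "k > 0"
  shows "(\<exists>B>0. \<forall>v. (\<Sum>i<k. \<bar>v \<bullet> vec_of (z i)\<bar>\<^sup>2) = B * (norm v)\<^sup>2) \<longleftrightarrow> (\<Sum>i<k. (z i)\<^sup>2) = 0"
proof -
  define S where "S = (\<Sum>i<k. (z i)\<^sup>2)"
  have eq: "(\<Sum>i<k. \<bar>vec_of w \<bullet> vec_of (z i)\<bar>\<^sup>2) = (real k * (norm w)\<^sup>2 + Re ((cnj w)\<^sup>2 * S)) / 2" for w
  proof -
    have "(\<Sum>i<k. \<bar>vec_of w \<bullet> vec_of (z i)\<bar>\<^sup>2) = (\<Sum>i<k. ((norm w)\<^sup>2 + Re ((cnj w)\<^sup>2 * (z i)\<^sup>2)) / 2)"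
      using z by (intro sum.cong) (simp_all add: inner_vec_of_squared)
    also have "\<dots> = (real k * (norm w)\<^sup>2 + Re ((cnj w)\<^sup>2 * S)) / 2"
      by (simp only: S_def sum.distrib sum_distrib_left Re_sum flip: sum_divide_distrib) simp
    finally show ?thesis .
  qed
  show ?thesis
    unfolding S_def[symmetric]
  proof
    assume "S = 0"
    have "(\<Sum>i<k. \<bar>v \<bullet> vec_of (z i)\<bar>\<^sup>2) = real k / 2 * (norm v)\<^sup>2" for v
    proof -
      obtain w where "v = vec_of w" using surj_vec_of by blast
      then show ?thesis using eq[of w] \<open>S = 0\<close> by simp
    qed
    then show "\<exists>B>0. \<forall>v. (\<Sum>i<k. \<bar>v \<bullet> vec_of (z i)\<bar>\<^sup>2) = B * (norm v)\<^sup>2"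
      using k by (intro exI[of _ "real k / 2"]) simp
  next
    assume "\<exists>B>0. \<forall>v. (\<Sum>i<k. \<bar>v \<bullet> vec_of (z i)\<bar>\<^sup>2) = B * (norm v)\<^sup>2"
    then obtain B where B_v: "\<And>v. (\<Sum>i<k. \<bar>v \<bullet> vec_of (z i)\<bar>\<^sup>2) = B * (norm v)\<^sup>2"
      by blast
    have B: "(real k * (norm w)\<^sup>2 + Re ((cnj w)\<^sup>2 * S)) / 2 = B * (norm w)\<^sup>2" for w
      using B_v[of "vec_of w"] unfolding eq by simp
    have "Re S = 0"
      using B[of 1] B[of \<i>] by simp
    moreover have "Im S = 0"
    proof -
      have "(cmod (1 + \<i>))\<^sup>2 = 2" "(cmod (1 - \<i>))\<^sup>2 = 2"
        by (simp_all add: cmod_power2)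
      moreover have "(cnj (1 + \<i>))\<^sup>2 = - 2 * \<i>" "(cnj (1 - \<i>))\<^sup>2 = 2 * \<i>"
        by (simp_all add: power2_eq_square algebra_simps)
      ultimately show ?thesis
        using B[of "1 + \<i>"] B[of "1 - \<i>"] by (simp del: complex_cnj_add complex_cnj_diff)
    qed
    ultimately show "S = 0" by (simp add: complex_eq_iff)
  qed
qed

text \<open>
  The list encoded by a configuration: the pairs fill the positions below \<open>2 * m\<close>, and the single
  number stands at position \<open>2 * m\<close> (and at all later ones, which are irrelevant).
\<close>
definition entries :: "nat \<Rightarrow> (nat \<Rightarrow> complex \<times> complex) \<times> complex \<Rightarrow> nat \<Rightarrow> complex" where
  "entries m p i = (if i < 2 * m then (if even i then fst else snd) (fst p (i div 2)) else snd p)"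

lemma sum_consecutive_pairs:
  fixes g :: "nat \<Rightarrow> 'a::comm_monoid_add"
  shows "(\<Sum>i<2 * m. g i) = (\<Sum>j<m. g (2 * j) + g (2 * j + 1))"
  by (induction m) (simp_all add: add_ac)

lemma sum_entries:
  assumes "b < 2"
  shows "(\<Sum>i<2 * m + b. (entries m (x, c) i)\<^sup>2) = of_nat b * c\<^sup>2 + (\<Sum>j<m. sqsum (x j))"
proof -
  have "(\<Sum>i<2 * m. (entries m (x, c) i)\<^sup>2) = (\<Sum>j<m. sqsum (x j))"
    unfolding sum_consecutive_pairs by (simp add: entries_def sqsum_def)
  moreover have "b = 0 \<or> b = 1" using assms by auto
  ultimately show ?thesis by (auto simp: entries_def add.commute)
qed

lemma norm_entries:
  assumes "(x, c) \<in> configs m e"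
  shows "norm (entries m (x, c) i) = 1"
proof (cases "i < 2 * m")
  case True
  then have "x (i div 2) \<in> unit_pairs" using assms by (auto simp: configs_def)
  then show ?thesis using True by (simp add: entries_def unit_pairs_def)
qed (use assms in \<open>simp add: entries_def configs_def\<close>)

theorem theorem7p4:
  fixes k :: nat
  assumes "k \<ge> 4"
  shows "connected_space (stf_space k :: (nat \<Rightarrow> real ^ 2) topology)"
proof -
  define m b where "m = k div 2" and "b = k mod 2"
  have m: "m \<ge> 2" and b: "b < 2" and k: "k = 2 * m + b"
    using assms by (auto simp: m_def b_def)
  let ?C = "configs m (of_nat b)"
  define \<Phi> :: "(nat \<Rightarrow> complex \<times> complex) \<times> complex \<Rightarrow> nat \<Rightarrow> real ^ 2"
    where "\<Phi> p = (\<lambda>i\<in>{..<k}. vec_of (entries m p i))" for p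
  have tight: "\<Phi> (x, c) \<in> spherical_tight_frames k" if xc: "(x, c) \<in> ?C" for x c
  proof -
    have "(\<Sum>i<k. (entries m (x, c) i)\<^sup>2) = 0"
      using xc unfolding k sum_entries[OF b] by (simp add: configs_def)
    then have "\<exists>B>0. \<forall>v. (\<Sum>i<k. \<bar>v \<bullet> vec_of (entries m (x, c) i)\<bar>\<^sup>2) = B * (norm v)\<^sup>2"
      using tight_iff_sum_squares_0[of k "entries m (x, c)"] norm_entries[OF xc] assms by simp
    then show ?thesis
      using norm_entries[OF xc] by (simp add: spherical_tight_frames_def \<Phi>_def)
  qed
  have surj: "f \<in> \<Phi> ` ?C" if f: "f \<in> spherical_tight_frames k" for f
  proof -
    have "\<forall>i. \<exists>z. f i = vec_of z" using surj_vec_of by blast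
    then obtain z where z: "\<And>i. f i = vec_of (z i)" by metis
    have z1: "\<And>i. i < k \<Longrightarrow> norm (z i) = 1"
      using f by (simp add: spherical_tight_frames_def z)
    have "(\<Sum>i<k. (z i)\<^sup>2) = 0"
      using tight_iff_sum_squares_0[of k z] z1 assms f by (simp add: spherical_tight_frames_def z)
    define x where "x j = (if j < m then (z (2 * j), z (2 * j + 1)) else 0)" for j
    \<comment> \<open>For even \<open>k\<close>, the free number has no position in the list and may be any unit number.\<close>
    define c where "c = (if b = 0 then 1 else z (2 * m))"
    have fr: "entries m (x, c) i = z i" if "i < k" for i
    proof (cases "i < 2 * m")
      case True
      then show ?thesis by (auto simp: entries_def x_def)
    next
      case False
      then have "i = 2 * m" "b \<noteq> 0" using that b by (auto simp: k)
      then show ?thesis by (simp add: entries_def c_def)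
    qed
    have "(\<Sum>i<k. (entries m (x, c) i)\<^sup>2) = 0"
      using \<open>(\<Sum>i<k. (z i)\<^sup>2) = 0\<close> fr by simp
    then have "of_nat b * c\<^sup>2 + (\<Sum>j<m. sqsum (x j)) = 0"
      unfolding k sum_entries[OF b] .
    moreover have "norm c = 1" using z1 by (auto simp: c_def k)
    moreover have "x j \<in> unit_pairs" if "j < m" for j
      using that z1[of "2 * j"] z1[of "2 * j + 1"] by (simp add: x_def unit_pairs_def k)
    ultimately have "(x, c) \<in> ?C" by (simp add: configs_def x_def)
    moreover have "\<Phi> (x, c) = f"
    proof
      show "\<Phi> (x, c) i = f i" for i
        using f fr z by (cases "i < k") (auto simp: \<Phi>_def spherical_tight_frames_def PiE_def extensional_def)
    qed
    ultimately show ?thesis by force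
  qed
  have image: "\<Phi> ` ?C = spherical_tight_frames k"
    using tight surj by force
  have "continuous_map (top_of_set ?C) (product_topology (\<lambda>_. euclidean) {..<k}) \<Phi>"
    unfolding continuous_map_componentwise
  proof (intro conjI ballI)
    show "\<Phi> ` topspace (top_of_set ?C) \<subseteq> extensional {..<k}"
      by (auto simp: \<Phi>_def)
    fix i assume i: "i \<in> {..<k}"
    have x: "continuous_on ?C (\<lambda>p. fst p j)" for j
      by (rule continuous_on_product_then_coordinatewise) (rule continuous_on_fst[OF continuous_on_id])
    have c: "continuous_on ?C (\<lambda>p. snd p)"
      by (rule continuous_on_snd[OF continuous_on_id])
    have "continuous_on ?C (\<lambda>p. entries m p i)"
      unfolding entries_def using c continuous_on_fst[OF x] continuous_on_snd[OF x]
      by (cases "i < 2 * m"; cases "even i") simp_all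
    then have "continuous_on ?C (\<lambda>p. vec_of (entries m p i))"
      by (rule continuous_on_vec_of)
    then show "continuous_map (top_of_set ?C) euclidean (\<lambda>p. \<Phi> p i)"
      using i by (simp add: \<Phi>_def)
  qed
  moreover have "connectedin (top_of_set ?C) ?C"
    using path_connected_imp_connected[OF path_connected_configs[OF m, of "of_nat b"]] b
    by (simp add: connectedin_subtopology)
  ultimately have "connectedin (product_topology (\<lambda>_. euclidean) {..<k}) (\<Phi> ` ?C)"
    by (rule connectedin_continuous_map_image)
  then show ?thesis
    unfolding image stf_space_def by (rule connected_space_subtopology)
qed

end
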